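(* Let $P$ be a program with set of controlled inputs $\mathcal A$ and finite set of uncontrolled inputs $\mathcal X$, and let $O$ be a set of finite traces. Let $q(P,O)$ denote the quantitative robustness of $O$ in $P$. Then $q(P,O)=0$ if and only if $O$ is not reachable in $P$, and $q(P,O)=1$ if and only if $O$ is robustly reachable in $P$.
   Context: A program $P$ is a deterministic transition system: a set of states $\mathcal S$ with a transition relation $\to$ under which each state has at most one successor. An input of $P$ is a pair $(a,x)$ with $a\in\mathcal A$ (controlled input, chosen by the attacker) and $x\in\mathcal X$ (uncontrolled input); $\mathcal A$ and $\mathcal X$ are nonempty and $\mathcal X$ is finite. Each input determines the initial state; all randomness is modelled as input. A (finite) trace is a finite sequence of consecutive states respecting $\to$ starting from an initial state; $T(P)$ is the set of traces of $P$. $P|_{(a,x)}$ denotes $P$ executed on input $(a,x)$, so $T(P|_{(a,x)})$ is the set of traces of $P$ starting in the initial state determined by $(a,x)$, and $T(P)=\bigcup_{(a,x)}T(P|_{(a,x)})$. Reachability: $O$ is reachable in $P$ when $T(P)\cap O\neq\varnothing$. Robust reachability: $O$ is robustly reachable in $P$ when $\exists a\in\mathcal A,\ \forall x\in\mathcal X,\ T(P|_{(a,x)})\cap O\neq\varnothing$. Quantitative robustness: $$q(P,O)=\frac1{|\mathcal X|}\max_{a\in\mathcal A}\left|\left\{x\in\mathcal X\mid T(P|_{(a,x)})\cap O\neq\varnothing\right\}\right|.$$ *)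

theory Defs
  imports Complex_Main
begin

record ('s, 'a, 'x) prog =
  states :: "'s set"
  trans_rel :: "('s \<times> 's) set"
  ctrl :: "'a set"
  unctrl :: "'x set"
  init :: "'a \<times> 'x \<Rightarrow> 's"

text \<open>Determinism is \<^const>\<open>single_valued\<close>: at most one successor per state. The set of
  controlled inputs may be infinite.\<close>

locale program =
  fixes P :: "('s, 'a, 'x) prog"
  assumes trans_states: "trans_rel P \<subseteq> states P \<times> states P"
    and deterministic: "single_valued (trans_rel P)"
    and ctrl_nonempty: "ctrl P \<noteq> {}"
    and unctrl_nonempty: "unctrl P \<noteq> {}"
    and finite_unctrl: "finite (unctrl P)"
    and init_states: "init P ` (ctrl P \<times> unctrl P) \<subseteq> states P"

definition initial_states :: "('s, 'a, 'x) prog \<Rightarrow> 's set" where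
  "initial_states P = init P ` (ctrl P \<times> unctrl P)"

text \<open>Traces are nonempty, because they start with an initial state. They need not be maximal.\<close>

definition traces :: "('s, 'a, 'x) prog \<Rightarrow> 's list set" where
  "traces P = {\<tau>. \<tau> \<noteq> [] \<and> hd \<tau> \<in> initial_states P \<and>
                   successively (\<lambda>s t. (s, t) \<in> trans_rel P) \<tau>}"

text \<open>The program executed on one input is the same transition system with that input as its
  only one.\<close>

definition on_input :: "('s, 'a, 'x) prog \<Rightarrow> 'a \<times> 'x \<Rightarrow> ('s, 'a, 'x) prog" where
  "on_input P i = P\<lparr>ctrl := {fst i}, unctrl := {snd i}\<rparr>"

lemma traces_eq_Union_on_input:
  "traces P = (\<Union>i \<in> ctrl P \<times> unctrl P. traces (on_input P i))"
  by (auto simp: traces_def initial_states_def on_input_def)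

definition reachable :: "('s, 'a, 'x) prog \<Rightarrow> 's list set \<Rightarrow> bool" where
  "reachable P \<O> \<longleftrightarrow> traces P \<inter> \<O> \<noteq> {}"

definition robustly_reachable :: "('s, 'a, 'x) prog \<Rightarrow> 's list set \<Rightarrow> bool" where
  "robustly_reachable P \<O> \<longleftrightarrow>
     (\<exists>a\<in>ctrl P. \<forall>x\<in>unctrl P. traces (on_input P (a, x)) \<inter> \<O> \<noteq> {})"

text \<open>Even for infinitely many controlled inputs the maximum is over a finite nonempty set, since
  all the cardinalities are at most that of the finite set of uncontrolled inputs.\<close>

definition quant_robustness :: "('s, 'a, 'x) prog \<Rightarrow> 's list set \<Rightarrow> real" where
  "quant_robustness P \<O> =
     1 / real (card (unctrl P)) *
     real (MAX a\<in>ctrl P. card {x \<in> unctrl P. traces (on_input P (a, x)) \<inter> \<O> \<noteq> {}})"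

end

theory Submission
  imports Defs
begin

text \<open>Let \<open>hits a\<close> be the set of uncontrolled inputs that lead to \<O> under
  \<open>a\<close>, and \<open>M\<close> the largest size of such a set. The robustness is
  \<open>M\<close> divided by the positive number \<open>card (unctrl P)\<close>, so it is 0 or 1
  exactly when \<open>M\<close> is 0 or \<open>card (unctrl P)\<close>. The first means that every
  \<open>hits a\<close> is empty; the second that some \<open>hits a\<close> is all of
  \<open>unctrl P\<close>, because a subset of a finite set with full cardinality is the whole
  set.\<close>

theorem proposition4p2:
  fixes P :: "('s, 'a, 'x) prog" and \<O> :: "'s list set"
  assumes "program P"
  shows "(quant_robustness P \<O> = 0 \<longleftrightarrow> \<not> reachable P \<O>) \<and>
         (quant_robustness P \<O> = 1 \<longleftrightarrow> robustly_reachable P \<O>)"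
proof -
  interpret program P by fact
  define hits where "hits a = {x \<in> unctrl P. traces (on_input P (a, x)) \<inter> \<O> \<noteq> {}}" for a
  define M where "M = (MAX a\<in>ctrl P. card (hits a))"
  have sub: "hits a \<subseteq> unctrl P" for a
    by (auto simp: hits_def)
  have fin_hits: "finite (hits a)" for a
    using sub finite_unctrl by (rule finite_subset)
  have le: "card (hits a) \<le> card (unctrl P)" for a
    using finite_unctrl sub by (rule card_mono)
  have fin: "finite ((\<lambda>a. card (hits a)) ` ctrl P)"
    by (rule finite_subset[of _ "{..card (unctrl P)}"]) (auto simp: le)
  have pos: "card (unctrl P) > 0"
    using finite_unctrl unctrl_nonempty by (simp add: card_gt_0_iff)
  have q: "quant_robustness P \<O> = real M / real (card (unctrl P))"
    by (simp add: quant_robustness_def M_def hits_def)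
  have M_ge: "card (hits a) \<le> M" if "a \<in> ctrl P" for a
    unfolding M_def using fin that by (intro Max_ge) auto
  \<comment> \<open>The maximum is attained, so a value of \<open>M\<close> says something about one
    controlled input \<open>b\<close>.\<close>
  have "M \<in> (\<lambda>a. card (hits a)) ` ctrl P"
    unfolding M_def using fin ctrl_nonempty by (intro Max_in) auto
  then obtain b where b: "b \<in> ctrl P" "M = card (hits b)"
    by auto
  have "M = 0 \<longleftrightarrow> (\<forall>a\<in>ctrl P. hits a = {})"
    using M_ge b fin_hits by (metis card_0_eq le_zero_eq)
  \<comment> \<open>Every trace of \<open>P\<close> is a trace on some single input, so \<O> is
    missed exactly when no pair of inputs hits it.\<close>
  also have "\<dots> \<longleftrightarrow> \<not> reachable P \<O>"
    by (auto simp: reachable_def traces_eq_Union_on_input[of P] hits_def)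
  finally have zero: "M = 0 \<longleftrightarrow> \<not> reachable P \<O>" .
  \<comment> \<open>Forwards the witness is \<open>b\<close>; backwards \<open>M_ge\<close> bounds
    \<open>M\<close> from below, and \<open>le\<close> at \<open>b\<close> from above.\<close>
  have "M = card (unctrl P) \<longleftrightarrow> (\<exists>a\<in>ctrl P. hits a = unctrl P)"
    using M_ge b le card_subset_eq[OF finite_unctrl sub] by (metis le_antisym)
  also have "\<dots> \<longleftrightarrow> robustly_reachable P \<O>"
    unfolding robustly_reachable_def hits_def by blast
  finally have one: "M = card (unctrl P) \<longleftrightarrow> robustly_reachable P \<O>" .
  show ?thesis
    using pos zero one by (auto simp: q)
qed

end
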